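(* Fix $q\in\mathbb{C}^{N^2}$ and a positive integer $n$. The following statements are equivalent: (a) There are no constants in $\mathcal{B}_q(n)$. (b) The equations $\partial_ix=y_i$, $i=1,\dots,N$, have a solution $x\in\mathcal{B}_q(n)$ for arbitrary $y_1,\dots,y_N\in\mathcal{B}_q(n-1)$. In this case the solution is unique.
   Context: Let $\mathcal{B}=\bigoplus_{n\ge0}\mathcal{B}(n)$ be the unital associative $\mathbb{C}$-algebra freely generated by $\xi_1,\dots,\xi_N$, graded by degree. Given $q=(q_{ij})\in\mathbb{C}^{N^2}$, $\mathcal{B}_q=\bigoplus_n\mathcal{B}_q(n)$ denotes $\mathcal{B}$ equipped with the linear operators $\partial_i$ determined by $\partial_i1=0$ and $\partial_i(\xi_jx)=\delta_{ij}x+q_{ij}\xi_j\partial_ix$ for all $x\in\mathcal{B}$. A constant in $\mathcal{B}_q$ is a nonzero element $C\in\bigoplus_{n\ge1}\mathcal{B}_q(n)$ with $\partial_iC=0$ for $i=1,\dots,N$. *)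

theory Defs
  imports Complex_Main "HOL-Library.Poly_Mapping"
begin

text \<open>
  Words under concatenation form the free monoid, written additively because multiplication of
  finitely supported functions is the convolution induced by addition of their arguments. Hence
  \<open>'i list \<Rightarrow>\<^sub>0 complex\<close> with its library ring structure is the free unital
  associative complex algebra on generators indexed by \<open>'i\<close>; these are
  \<open>\<xi>\<^sub>1, \<dots>, \<xi>\<^sub>N\<close> with \<open>N = CARD('i)\<close>.
\<close>

instantiation list :: (type) monoid_add
begin

definition zero_list :: "'a list" where "zero_list = []"

definition plus_list :: "'a list \<Rightarrow> 'a list \<Rightarrow> 'a list" where "plus_list = (@)"

instance
  by standard (simp_all add: zero_list_def plus_list_def)

end

type_synonym 'i free_algebra = "'i list \<Rightarrow>\<^sub>0 complex"

definition generator :: "'i \<Rightarrow> 'i free_algebra" (\<open>\<xi>\<close>) where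
  "\<xi> j = Poly_Mapping.single [j] 1"

definition scale :: "complex \<Rightarrow> 'i free_algebra \<Rightarrow> 'i free_algebra" where
  "scale c x = Poly_Mapping.single [] c * x"

definition homogeneous :: "nat \<Rightarrow> 'i free_algebra set" (\<open>\<B>\<close>) where
  "\<B> n = {x. \<forall>w \<in> Poly_Mapping.keys x. length w = n}"

definition positive_part :: "'i free_algebra set" where
  "positive_part = {x. \<exists>A f. finite A \<and> A \<subseteq> {1..} \<and> (\<forall>n\<in>A. f n \<in> \<B> n) \<and> x = (\<Sum>n\<in>A. f n)}"

primrec word_deriv :: "('i \<Rightarrow> 'i \<Rightarrow> complex) \<Rightarrow> 'i \<Rightarrow> 'i list \<Rightarrow> 'i free_algebra" where
  "word_deriv q i [] = 0"
| "word_deriv q i (j # w) =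
     (if i = j then Poly_Mapping.single w 1 else 0) + scale (q i j) (\<xi> j * word_deriv q i w)"

text \<open>
  The linear extension of \<open>word_deriv\<close>; lemmas \<open>skew_deriv_linear\<close>,
  \<open>skew_deriv_one\<close>, \<open>skew_deriv_generator_mult\<close> and \<open>skew_deriv_unique\<close> below show that it
  is the unique linear operator satisfying the defining relations.
\<close>

definition skew_deriv :: "('i \<Rightarrow> 'i \<Rightarrow> complex) \<Rightarrow> 'i \<Rightarrow> 'i free_algebra \<Rightarrow> 'i free_algebra" (\<open>\<partial>\<close>) where
  "\<partial> q i x = (\<Sum>w\<in>Poly_Mapping.keys x. scale (Poly_Mapping.lookup x w) (word_deriv q i w))"

definition is_constant :: "('i \<Rightarrow> 'i \<Rightarrow> complex) \<Rightarrow> 'i free_algebra \<Rightarrow> bool" where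
  "is_constant q C \<longleftrightarrow> C \<noteq> 0 \<and> C \<in> positive_part \<and> (\<forall>i. \<partial> q i C = 0)"


lemma one_eq_single: "(1 :: 'i free_algebra) = Poly_Mapping.single [] 1"
  by (simp add: zero_list_def[symmetric])

lemma lookup_scale [simp]:
  "Poly_Mapping.lookup (scale c x) w = c * Poly_Mapping.lookup x w"
  unfolding scale_def zero_list_def[symmetric]
  by (simp add: mult_map_scale_conv_mult[symmetric] Poly_Mapping.map.rep_eq when_def)

lemma vector_space_scale: "vector_space scale"
  by unfold_locales (auto intro!: poly_mapping_eqI simp: lookup_add algebra_simps)

interpretation free_algebra: vector_space scale
  by (rule vector_space_scale)

lemma scale_single [simp]:
  "scale c (Poly_Mapping.single w a) = Poly_Mapping.single w (c * a)"
  by (rule poly_mapping_eqI) (auto simp: lookup_single when_def)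

lemma generator_mult_single [simp]:
  "\<xi> j * Poly_Mapping.single w a = Poly_Mapping.single (j # w) a"
  by (simp add: generator_def mult_single plus_list_def)

lemma mult_scale_right: "\<xi> j * scale c x = scale c (\<xi> j * x)"
proof -
  have "\<xi> j * Poly_Mapping.single [] c = Poly_Mapping.single [] c * \<xi> j"
    by (simp add: generator_def mult_single plus_list_def)
  then show ?thesis
    unfolding scale_def by (metis mult.assoc)
qed

lemma free_algebra_expansion:
  "x = (\<Sum>w\<in>Poly_Mapping.keys x. scale (Poly_Mapping.lookup x w) (Poly_Mapping.single w 1))"
  by (rule poly_mapping_eqI)
     (auto simp: lookup_sum lookup_single when_def sum.delta' in_keys_iff if_distrib cong: if_cong)

lemma skew_deriv_superset:
  assumes "finite A" "Poly_Mapping.keys x \<subseteq> A"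
  shows "\<partial> q i x = (\<Sum>w\<in>A. scale (Poly_Mapping.lookup x w) (word_deriv q i w))"
  unfolding skew_deriv_def using assms
  by (intro sum.mono_neutral_left) (auto simp: in_keys_iff)

lemma skew_deriv_linear: "Vector_Spaces.linear scale scale (\<partial> q i)"
proof (unfold_locales)
  fix x y :: "'a free_algebra" and c :: complex
  let ?A = "Poly_Mapping.keys x \<union> Poly_Mapping.keys y"
  have "Poly_Mapping.keys (x + y) \<subseteq> ?A" by (rule Poly_Mapping.keys_add)
  then show "\<partial> q i (x + y) = \<partial> q i x + \<partial> q i y"
    by (simp add: skew_deriv_superset[of ?A] lookup_add free_algebra.scale_left_distrib sum.distrib)
  have "Poly_Mapping.keys (scale c x) \<subseteq> Poly_Mapping.keys x" by (auto simp: in_keys_iff)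
  then show "\<partial> q i (scale c x) = scale c (\<partial> q i x)"
    by (simp add: skew_deriv_superset[of "Poly_Mapping.keys x"] free_algebra.scale_sum_right)
qed

lemma skew_deriv_one: "\<partial> q i 1 = 0"
  by (simp add: skew_deriv_def one_eq_single)

lemma skew_deriv_single: "\<partial> q i (Poly_Mapping.single w a) = scale a (word_deriv q i w)"
  by (simp add: skew_deriv_def)

lemma linear_eq_on_words:
  assumes "Vector_Spaces.linear scale scale f" "Vector_Spaces.linear scale scale g"
    and "\<And>w. f (Poly_Mapping.single w 1) = g (Poly_Mapping.single w 1)"
  shows "f x = g x"
proof -
  interpret f: Vector_Spaces.linear scale scale f by fact
  interpret g: Vector_Spaces.linear scale scale g by fact
  show ?thesis
    by (subst (1 2) free_algebra_expansion[of x]) (simp add: f.sum g.sum f.scale g.scale assms(3) del: scale_single)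
qed

lemma skew_deriv_generator_mult:
  "\<partial> q i (\<xi> j * x) = (if i = j then x else 0) + scale (q i j) (\<xi> j * \<partial> q i x)"
proof -
  interpret d: Vector_Spaces.linear scale scale "\<partial> q i" by (rule skew_deriv_linear)
  have 1: "Vector_Spaces.linear scale scale (\<lambda>x. \<partial> q i (\<xi> j * x))"
    by unfold_locales (simp_all add: distrib_left d.add d.scale mult_scale_right)
  have 2: "Vector_Spaces.linear scale scale
      (\<lambda>x. (if i = j then x else 0) + scale (q i j) (\<xi> j * \<partial> q i x))"
    by unfold_locales
       (simp_all add: distrib_left d.add d.scale mult_scale_right free_algebra.scale_right_distrib
         mult.commute)
  show ?thesis
    by (rule linear_eq_on_words[OF 1 2]) (simp add: skew_deriv_single)
qed

lemma skew_deriv_unique: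
  assumes "Vector_Spaces.linear scale scale D"
    and "D 1 = 0"
    and "\<And>j x. D (\<xi> j * x) = (if i = j then x else 0) + scale (q i j) (\<xi> j * D x)"
  shows "D = \<partial> q i"
proof
  fix x
  show "D x = \<partial> q i x"
  proof (rule linear_eq_on_words[OF assms(1) skew_deriv_linear])
    fix w show "D (Poly_Mapping.single w 1) = \<partial> q i (Poly_Mapping.single w 1)"
    proof (induction w)
      case Nil
      then show ?case using assms(2) skew_deriv_one[of q i] by (simp add: one_eq_single)
    next
      case (Cons j w)
      then show ?case
        using assms(3)[of j "Poly_Mapping.single w 1"]
          skew_deriv_generator_mult[of q i j "Poly_Mapping.single w 1"] by simp
    qed
  qed
qed

end

theory Submission
  imports Defs
begin

text \<open>
  The equivalence of (a) and (b) is the theorem that a linear endomorphism of a finite-dimensional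
  space is injective if and only if it is surjective. Sorting the words of an element of positive
  degree by their first letters shows that \<open>(y\<^sub>i) \<mapsto> \<Sum>\<^sub>i \<xi>\<^sub>i y\<^sub>i\<close> is an
  isomorphism from \<open>\<B>(n - 1)\<^sup>N\<close> onto \<open>\<B>(n)\<close> (lemmas \<open>join_letters_eq_iff\<close> and
  \<open>homogeneous_Suc_join_letters\<close>). Therefore the system \<open>\<partial>\<^sub>i x = y\<^sub>i\<close> is a
  single equation for the operator \<open>x \<mapsto> \<Sum>\<^sub>i \<xi>\<^sub>i \<partial>\<^sub>i x\<close>. Each
  \<open>\<partial>\<^sub>i\<close> lowers the degree by one, so this operator maps \<open>\<B>(n)\<close> to itself, and
  \<open>\<B>(n)\<close> is spanned by the finitely many words of length \<open>n\<close>. The kernel of the operator on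
  \<open>\<B>(n)\<close> consists of zero and the constants of degree \<open>n\<close>. So (a) says that the operator is
  injective on \<open>\<B>(n)\<close>, which is also the uniqueness of solutions, and (b) says that it is onto.
\<close>

section \<open>Endomorphisms of finitely spanned subspaces\<close>

text \<open>
  The free algebra itself is infinite-dimensional, so the equivalence of injectivity and
  surjectivity is proved here for a finitely spanned subspace. The image of a basis under an
  injective map is an independent family of the same size; a vector outside its span could be added
  to it, giving more independent vectors than the basis has elements.
\<close>

lemma (in vector_space) linear_inj_on_span_imp_surj:
  assumes f: "Vector_Spaces.linear scale scale f"
    and fin: "finite S" and into: "f ` span S \<subseteq> span S" and inj: "inj_on f (span S)"
  shows "f ` span S = span S"
proof -
  interpret f: Vector_Spaces.linear scale scale f by fact
  obtain B where B: "B \<subseteq> S" "independent B" "S \<subseteq> span B"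
    by (rule maximal_independent_subset[of S])
  have span_B: "span B = span S"
    by (rule subset_antisym[OF span_mono[OF B(1)] span_minimal[OF B(3) subspace_span]])
  have finB: "finite B"
    by (rule finite_subset[OF B(1) fin])
  have indep: "independent (f ` B)"
    using f.independent_injective_image B(2) inj span_B by simp
  have fB: "f ` B \<subseteq> span B"
    using into span_superset[of B] span_B by blast
  have card: "card (f ` B) = card B"
    by (rule card_image[OF inj_on_subset[OF inj[folded span_B] span_superset]])
  have "span B \<subseteq> span (f ` B)"
  proof
    fix v assume v: "v \<in> span B"
    show "v \<in> span (f ` B)"
    proof (rule ccontr)
      assume not_in: "v \<notin> span (f ` B)"
      then have "v \<notin> f ` B"
        using span_base by blast
      then have "card (insert v (f ` B)) = Suc (card B)"
        using finB card by simp
      moreover have "card (insert v (f ` B)) \<le> card B"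
        using independent_span_bound[OF finB independent_insertI[OF not_in indep]] v fB by simp
      ultimately show False
        by simp
    qed
  qed
  then show ?thesis
    using into by (simp add: f.span_image span_B)
qed

text \<open>
  A linear right inverse on the subspace is injective, hence onto by the preceding lemma, so that
  it is a two-sided inverse.
\<close>

lemma (in vector_space) linear_inj_on_span_iff_surj:
  assumes f: "Vector_Spaces.linear scale scale f"
    and fin: "finite S" and into: "f ` span S \<subseteq> span S"
  shows "inj_on f (span S) \<longleftrightarrow> f ` span S = span S"
proof
  assume "inj_on f (span S)"
  then show "f ` span S = span S"
    by (rule linear_inj_on_span_imp_surj[OF f fin into])
next
  assume surj: "f ` span S = span S"
  interpret pair: vector_space_pair scale scale
    by unfold_locales
  obtain g where g: "range g \<subseteq> span S" "Vector_Spaces.linear scale scale g"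
      "\<forall>v\<in>span S. f (g v) = v"
    using pair.linear_surj_right_inverse[OF f equalityD2[OF surj]] by blast
  have "inj_on g (span S)"
    using g(3) by (intro inj_on_inverseI[of _ f]) blast
  then have "g ` span S = span S"
    using linear_inj_on_span_imp_surj[OF g(2) fin] g(1) by blast
  moreover have "inj_on f (g ` span S)"
    using g(3) by (intro inj_on_inverseI[of _ g]) auto
  ultimately show "inj_on f (span S)"
    by simp
qed

section \<open>Homogeneous components\<close>

lemma homogeneous_iff: "x \<in> \<B> n \<longleftrightarrow> (\<forall>w. Poly_Mapping.lookup x w \<noteq> 0 \<longrightarrow> length w = n)"
  by (auto simp: homogeneous_def in_keys_iff)

lemma subspace_homogeneous: "free_algebra.subspace (\<B> n)"
proof (rule free_algebra.subspaceI)
  show "0 \<in> \<B> n"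
    by (simp add: homogeneous_def)
next
  fix x y :: "'a free_algebra" assume "x \<in> \<B> n" "y \<in> \<B> n"
  then show "x + y \<in> \<B> n"
    using Poly_Mapping.keys_add[of x y] unfolding homogeneous_def by blast
next
  fix c and x :: "'a free_algebra" assume "x \<in> \<B> n"
  then show "scale c x \<in> \<B> n"
    unfolding homogeneous_iff lookup_scale mult_eq_0_iff by blast
qed

lemma homogeneous_eq_span:
  "\<B> n = free_algebra.span ((\<lambda>w. Poly_Mapping.single w 1) ` {w. length w = n})"
    (is "_ = free_algebra.span ?W")
proof
  show "\<B> n \<subseteq> free_algebra.span ?W"
  proof
    fix x :: "'a free_algebra" assume "x \<in> \<B> n"
    then have "(\<Sum>w\<in>Poly_Mapping.keys x.
        scale (Poly_Mapping.lookup x w) (Poly_Mapping.single w 1)) \<in> free_algebra.span ?W"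
      by (intro free_algebra.span_sum free_algebra.span_scale free_algebra.span_base)
         (auto simp: homogeneous_def)
    then show "x \<in> free_algebra.span ?W"
      unfolding free_algebra_expansion[of x, symmetric] .
  qed
  show "free_algebra.span ?W \<subseteq> \<B> n"
    by (rule free_algebra.span_minimal[OF _ subspace_homogeneous])
       (auto simp: homogeneous_def)
qed

lemma finite_words: "finite {w :: 'i::finite list. length w = n}"
  using finite_lists_length_eq[of "UNIV :: 'i set" n] by simp

lemma homogeneous_subset_positive_part:
  assumes "n \<ge> 1" "x \<in> \<B> n"
  shows "x \<in> positive_part"
  unfolding positive_part_def
  by (rule CollectI, rule exI[of _ "{n}"], rule exI[of _ "\<lambda>_. x"]) (use assms in simp)

section \<open>Sorting words by their first letter\<close>

lemma generator_mult_expansion: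
  "\<xi> j * x = (\<Sum>w\<in>Poly_Mapping.keys x. Poly_Mapping.single (j # w) (Poly_Mapping.lookup x w))"
proof -
  have "\<xi> j * x = \<xi> j * (\<Sum>w\<in>Poly_Mapping.keys x.
      scale (Poly_Mapping.lookup x w) (Poly_Mapping.single w 1))"
    by (rule arg_cong[OF free_algebra_expansion])
  then show ?thesis
    by (simp add: sum_distrib_left)
qed

lemma lookup_generator_mult_Nil [simp]: "Poly_Mapping.lookup (\<xi> j * x) [] = 0"
  by (simp add: generator_mult_expansion lookup_sum lookup_single)

lemma lookup_generator_mult_Cons [simp]:
  "Poly_Mapping.lookup (\<xi> j * x) (k # w) = (if j = k then Poly_Mapping.lookup x w else 0)"
  by (auto simp: generator_mult_expansion lookup_sum lookup_single when_def in_keys_iff)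

lemma generator_mult_homogeneous: "x \<in> \<B> n \<Longrightarrow> \<xi> j * x \<in> \<B> (Suc n)"
proof (unfold homogeneous_iff, intro allI impI)
  fix w
  assume "\<forall>w. Poly_Mapping.lookup x w \<noteq> 0 \<longrightarrow> length w = n"
    "Poly_Mapping.lookup (\<xi> j * x) w \<noteq> 0"
  then show "length w = Suc n"
    by (cases w) (auto split: if_splits)
qed

definition join_letters :: "('i::finite \<Rightarrow> 'i free_algebra) \<Rightarrow> 'i free_algebra" where
  "join_letters y = (\<Sum>i\<in>UNIV. \<xi> i * y i)"

lemma lookup_join_letters_Cons [simp]:
  "Poly_Mapping.lookup (join_letters y) (k # w) = Poly_Mapping.lookup (y k) w"
  by (simp add: join_letters_def lookup_sum)

lemma join_letters_eq_iff: "join_letters y = join_letters z \<longleftrightarrow> y = z"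
proof
  assume "join_letters y = join_letters z"
  then have "Poly_Mapping.lookup (y i) w = Poly_Mapping.lookup (z i) w" for i w
    by (metis lookup_join_letters_Cons)
  then show "y = z"
    by (intro ext poly_mapping_eqI)
qed simp

lemma join_letters_homogeneous:
  assumes "\<And>i. y i \<in> \<B> n"
  shows "join_letters y \<in> \<B> (Suc n)"
  unfolding join_letters_def
  by (intro free_algebra.subspace_sum subspace_homogeneous generator_mult_homogeneous assms)

text \<open>
  The component of \<open>x\<close> at the letter \<open>i\<close> has coefficient \<open>x(iw)\<close> at the word \<open>w\<close>; it is finitely
  supported because prefixing \<open>i\<close> is injective.
\<close>

lemma homogeneous_Suc_join_letters:
  fixes x :: "'i::finite free_algebra"
  assumes x: "x \<in> \<B> (Suc n)"
  obtains y where "\<And>i. y i \<in> \<B> n" "x = join_letters y"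
proof
  define y where "y i = Abs_poly_mapping (\<lambda>w. Poly_Mapping.lookup x (i # w))" for i
  have lookup_y: "Poly_Mapping.lookup (y i) w = Poly_Mapping.lookup x (i # w)" for i w
  proof -
    have "finite ((#) i -` {w. Poly_Mapping.lookup x w \<noteq> 0})"
      by (intro finite_vimageI finite_lookup) simp
    then show ?thesis
      by (simp add: y_def Abs_poly_mapping_inverse vimage_def)
  qed
  show "y i \<in> \<B> n" for i
    using x by (fastforce simp: homogeneous_iff lookup_y)
  show "x = join_letters y"
  proof (rule poly_mapping_eqI)
    fix w show "Poly_Mapping.lookup x w = Poly_Mapping.lookup (join_letters y) w"
      using x by (cases w) (auto simp: homogeneous_iff lookup_y join_letters_def lookup_sum)
  qed
qed

section \<open>The operator collecting the skew derivatives\<close>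

lemma word_deriv_homogeneous: "length w = Suc n \<Longrightarrow> word_deriv q i w \<in> \<B> n"
proof (induction w arbitrary: n)
  case (Cons j w)
  \<comment> \<open>A word of length one is a separate case: the derivative of its empty tail is zero.\<close>
  have "\<xi> j * word_deriv q i w \<in> \<B> n"
  proof (cases n)
    case 0
    then show ?thesis
      using Cons.prems by (simp add: homogeneous_def)
  next
    case (Suc m)
    then show ?thesis
      using Cons by (simp add: generator_mult_homogeneous)
  qed
  moreover have "(if i = j then Poly_Mapping.single w 1 else 0) \<in> \<B> n"
    using Cons.prems by (simp add: homogeneous_def)
  ultimately show ?case
    unfolding word_deriv.simps
    by (intro free_algebra.subspace_add free_algebra.subspace_scale subspace_homogeneous)
qed simp

lemma skew_deriv_homogeneous:
  assumes "x \<in> \<B> (Suc n)"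
  shows "\<partial> q i x \<in> \<B> n"
  unfolding skew_deriv_def using assms
  by (intro free_algebra.subspace_sum free_algebra.subspace_scale subspace_homogeneous
        word_deriv_homogeneous) (simp add: homogeneous_def)

definition joined_deriv ::
    "('i::finite \<Rightarrow> 'i \<Rightarrow> complex) \<Rightarrow> 'i free_algebra \<Rightarrow> 'i free_algebra" where
  "joined_deriv q x = join_letters (\<lambda>i. \<partial> q i x)"

lemma joined_deriv_linear: "Vector_Spaces.linear scale scale (joined_deriv q)"
proof -
  have add: "\<partial> q i (x + y) = \<partial> q i x + \<partial> q i y"
    and scale: "\<partial> q i (scale c x) = scale c (\<partial> q i x)" for i c x y
  proof -
    interpret d: Vector_Spaces.linear scale scale "\<partial> q i"
      by (rule skew_deriv_linear)
    show "\<partial> q i (x + y) = \<partial> q i x + \<partial> q i y" "\<partial> q i (scale c x) = scale c (\<partial> q i x)"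
      by (rule d.add, rule d.scale)
  qed
  show ?thesis
    by unfold_locales
       (simp_all add: joined_deriv_def join_letters_def add scale distrib_left sum.distrib
          mult_scale_right free_algebra.scale_sum_right)
qed

lemma joined_deriv_homogeneous: "x \<in> \<B> (Suc n) \<Longrightarrow> joined_deriv q x \<in> \<B> (Suc n)"
  unfolding joined_deriv_def by (intro join_letters_homogeneous skew_deriv_homogeneous)

lemma joined_deriv_eq_iff: "joined_deriv q x = join_letters y \<longleftrightarrow> (\<forall>i. \<partial> q i x = y i)"
  by (simp add: joined_deriv_def join_letters_eq_iff fun_eq_iff)

lemma joined_deriv_eq_0_iff: "joined_deriv q x = 0 \<longleftrightarrow> (\<forall>i. \<partial> q i x = 0)"
  using joined_deriv_eq_iff[of q x "\<lambda>_. 0"] by (simp add: join_letters_def)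

section \<open>Constants and the equations for the skew derivatives\<close>

lemma no_constants_iff_inj_on:
  fixes q :: "'i::finite \<Rightarrow> 'i \<Rightarrow> complex"
  assumes "n \<ge> 1"
  shows "(\<nexists>C. C \<in> \<B> n \<and> is_constant q C) \<longleftrightarrow> inj_on (joined_deriv q) (\<B> n)"
proof -
  interpret pair: vector_space_pair
      "scale :: _ \<Rightarrow> 'i free_algebra \<Rightarrow> _" "scale :: _ \<Rightarrow> 'i free_algebra \<Rightarrow> _"
    by unfold_locales
  show ?thesis
    using homogeneous_subset_positive_part[OF assms]
    by (auto simp: pair.linear_inj_on_iff_eq_0[OF joined_deriv_linear subspace_homogeneous]
        is_constant_def joined_deriv_eq_0_iff)
qed

lemma solvable_iff_surj_on:
  fixes q :: "'i::finite \<Rightarrow> 'i \<Rightarrow> complex"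
  shows "(\<forall>y :: 'i \<Rightarrow> 'i free_algebra. (\<forall>i. y i \<in> \<B> n)
      \<longrightarrow> (\<exists>x \<in> \<B> (Suc n). \<forall>i. \<partial> q i x = y i))
    \<longleftrightarrow> joined_deriv q ` \<B> (Suc n) = \<B> (Suc n)" (is "?solvable \<longleftrightarrow> ?surj")
proof
  assume solvable: ?solvable
  show ?surj
  proof
    show "joined_deriv q ` \<B> (Suc n) \<subseteq> \<B> (Suc n)"
      using joined_deriv_homogeneous by blast
    show "\<B> (Suc n) \<subseteq> joined_deriv q ` \<B> (Suc n)"
    proof
      fix z :: "'i free_algebra" assume "z \<in> \<B> (Suc n)"
      then obtain y where y: "\<And>i. y i \<in> \<B> n" "z = join_letters y"
        using homogeneous_Suc_join_letters by blast
      then obtain x where "x \<in> \<B> (Suc n)" "\<forall>i. \<partial> q i x = y i"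
        using solvable by blast
      then show "z \<in> joined_deriv q ` \<B> (Suc n)"
        using y(2) joined_deriv_eq_iff[of q x y] by (intro image_eqI[of _ _ x]) simp_all
    qed
  qed
next
  assume surj: ?surj
  show ?solvable
  proof (intro allI impI)
    fix y :: "'i \<Rightarrow> 'i free_algebra" assume "\<forall>i. y i \<in> \<B> n"
    then have "join_letters y \<in> joined_deriv q ` \<B> (Suc n)"
      using join_letters_homogeneous surj by blast
    then obtain x where "x \<in> \<B> (Suc n)" "joined_deriv q x = join_letters y"
      by auto
    then show "\<exists>x \<in> \<B> (Suc n). \<forall>i. \<partial> q i x = y i"
      using joined_deriv_eq_iff by blast
  qed
qed

lemma joined_deriv_inj_on_iff_surj_on:
  "inj_on (joined_deriv q) (\<B> (Suc n)) \<longleftrightarrow> joined_deriv q ` \<B> (Suc n) = \<B> (Suc n)"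
proof -
  let ?W = "(\<lambda>w. Poly_Mapping.single w 1) ` {w :: 'a list. length w = Suc n}"
  have span: "free_algebra.span ?W = \<B> (Suc n)"
    by (rule homogeneous_eq_span[symmetric])
  have "finite ?W"
    by (rule finite_imageI[OF finite_words])
  moreover have "joined_deriv q ` \<B> (Suc n) \<subseteq> \<B> (Suc n)"
    using joined_deriv_homogeneous by blast
  ultimately show ?thesis
    using free_algebra.linear_inj_on_span_iff_surj[OF joined_deriv_linear, of ?W] unfolding span
    by simp
qed

theorem proposition1p4p1:
  fixes q :: "'i::finite \<Rightarrow> 'i \<Rightarrow> complex" and n :: nat
  assumes "n \<ge> 1"
  shows "((\<nexists>C. C \<in> \<B> n \<and> is_constant q C)
          \<longleftrightarrow> (\<forall>y :: 'i \<Rightarrow> 'i free_algebra. (\<forall>i. y i \<in> \<B> (n - 1)) \<longrightarrow> (\<exists>x \<in> \<B> n. \<forall>i. \<partial> q i x = y i)))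
       \<and> ((\<nexists>C. C \<in> \<B> n \<and> is_constant q C)
          \<longrightarrow> (\<forall>y :: 'i \<Rightarrow> 'i free_algebra. (\<forall>i. y i \<in> \<B> (n - 1)) \<longrightarrow> (\<exists>!x. x \<in> \<B> n \<and> (\<forall>i. \<partial> q i x = y i))))"
proof -
  have n: "Suc (n - 1) = n"
    using assms by simp
  have equivalence: "(\<nexists>C. C \<in> \<B> n \<and> is_constant q C)
      \<longleftrightarrow> (\<forall>y :: 'i \<Rightarrow> 'i free_algebra. (\<forall>i. y i \<in> \<B> (n - 1)) \<longrightarrow> (\<exists>x \<in> \<B> n. \<forall>i. \<partial> q i x = y i))"
    using no_constants_iff_inj_on[OF assms, of q] joined_deriv_inj_on_iff_surj_on[of q "n - 1"]
      solvable_iff_surj_on[of "n - 1" q]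
    by (simp only: n)
  have unique: "x = x'"
    if none: "\<nexists>C. C \<in> \<B> n \<and> is_constant q C" and x: "x \<in> \<B> n" "\<forall>i. \<partial> q i x = y i"
      and x': "x' \<in> \<B> n" "\<forall>i. \<partial> q i x' = y i" for x x' y
  proof -
    have "inj_on (joined_deriv q) (\<B> n)"
      using none no_constants_iff_inj_on[OF assms] by blast
    moreover have "joined_deriv q x = joined_deriv q x'"
      using x(2) x'(2) by (simp add: joined_deriv_def)
    ultimately show ?thesis
      using x(1) x'(1) by (rule inj_onD)
  qed
  have "\<exists>!x. x \<in> \<B> n \<and> (\<forall>i. \<partial> q i x = y i)"
    if none: "\<nexists>C. C \<in> \<B> n \<and> is_constant q C" and y: "\<forall>i. y i \<in> \<B> (n - 1)" for y
  proof -
    obtain x where x: "x \<in> \<B> n" "\<forall>i. \<partial> q i x = y i"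
      using equivalence[THEN iffD1, OF none] y by blast
    show ?thesis
    proof (rule ex1I[of _ x])
      show "x \<in> \<B> n \<and> (\<forall>i. \<partial> q i x = y i)"
        using x by (rule conjI)
    next
      fix x' assume "x' \<in> \<B> n \<and> (\<forall>i. \<partial> q i x' = y i)"
      then show "x' = x"
        by (elim conjE) (rule unique[OF none _ _ x])
    qed
  qed
  then have "(\<nexists>C. C \<in> \<B> n \<and> is_constant q C)
      \<longrightarrow> (\<forall>y :: 'i \<Rightarrow> 'i free_algebra. (\<forall>i. y i \<in> \<B> (n - 1)) \<longrightarrow> (\<exists>!x. x \<in> \<B> n \<and> (\<forall>i. \<partial> q i x = y i)))"
    by (intro impI allI)
  with equivalence show ?thesis
    by (rule conjI)
qed

end
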